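(* Let $v_1,\dots,v_k\in\mathbb{N}^k$ be integer vectors that are linearly independent in $\mathbb{R}^k$, none of which is parallel to a coordinate axis. Let $U=\{a_1v_1+\cdots+a_kv_k : a_i\in\mathbb{R}_{\geq 0}\}$ be the cone they generate and $V=U\cap\mathbb{N}^k$. Let $S$ be the set of all integer points of the simplex $\{a_1(kv_1)+\cdots+a_k(kv_k): a_i\geq 0,\ a_1+\cdots+a_k\leq 1\}$, let $X_i=\{v_i,2v_i,4v_i,8v_i,\dots\}=\{2^jv_i: j\geq 0\}$ for $i=1,\dots,k$, and let $X=S\cup X_1\cup\cdots\cup X_k$. Then $V=FS(X)$, and $X$ is thin: there is a constant $t_X$ such that $|X\cap[1,N]^k|\leq \log_2|V\cap[1,N]^k|+t_X$ for all sufficiently large $N$.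
   Context: $\mathbb{N}=\{1,2,\dots\}$. For $X\subseteq\mathbb{N}^k$ (or $\mathbb{Z}^k$), $FS(X)$ denotes the set of all finite sums of distinct elements of $X$. A set $X$ is called a thin complete set with respect to a region $R\subseteq\mathbb{N}^k$ if $FS(X)\supseteq R$ and $X(N)\leq \log_2 R(N)+t_X$ for some constant $t_X$, where $X(N)$, $R(N)$ denote the number of points of $X$, resp. $R$, in $[1,N]^k$.
   Formalization: The origin, an integer point of the simplex, is left out of S, and FS(X) takes only nonempty sums; otherwise 0 would lie in FS(X) but not in V, since V consists of points with positive coordinates. *)

theory Defs
  imports "HOL-Analysis.Analysis"
begin

text \<open>The set \<open>\<nat>\<^sup>k\<close> with \<open>\<nat> = {1, 2, \<dots>}\<close>, inside \<open>\<real>\<^sup>k\<close>; the dimension is \<open>k = CARD('k)\<close>.\<close>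

definition pos_points :: "(real ^ 'k) set" where
  "pos_points = {x. \<forall>i. x $ i \<in> \<nat> \<and> x $ i \<noteq> 0}"

text \<open>Sums are over nonempty sets of summands: the empty sum \<open>0\<close> is not in \<open>\<nat>\<^sup>k\<close>.\<close>

definition FS :: "(real ^ 'k) set \<Rightarrow> (real ^ 'k) set" where
  "FS X = {\<Sum>x\<in>F. x | F. F \<subseteq> X \<and> finite F \<and> F \<noteq> {}}"

definition count_upto :: "(real ^ 'k) set \<Rightarrow> nat \<Rightarrow> nat" where
  "count_upto A N = card (A \<inter> {x. \<forall>i. 1 \<le> x $ i \<and> x $ i \<le> real N})"

definition parallel_to_axis :: "real ^ 'k \<Rightarrow> bool" where
  "parallel_to_axis x \<longleftrightarrow> (\<exists>j c. x = c *\<^sub>R axis j 1)"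

definition gen_cone :: "('k::finite \<Rightarrow> real ^ 'k) \<Rightarrow> (real ^ 'k) set" where
  "gen_cone v = {\<Sum>i\<in>UNIV. a i *\<^sub>R v i | a. \<forall>i. a i \<ge> 0}"

definition cone_points :: "('k::finite \<Rightarrow> real ^ 'k) \<Rightarrow> (real ^ 'k) set" where
  "cone_points v = gen_cone v \<inter> pos_points"

definition gen_simplex :: "('k::finite \<Rightarrow> real ^ 'k) \<Rightarrow> (real ^ 'k) set" where
  "gen_simplex v = {\<Sum>i\<in>UNIV. a i *\<^sub>R (real CARD('k) *\<^sub>R v i) | a.
     (\<forall>i. a i \<ge> 0) \<and> (\<Sum>i\<in>UNIV. a i) \<le> 1}"

text \<open>For \<open>v i \<in> \<nat>\<^sup>k\<close> this leaves out exactly one integer point of the simplex, the origin, which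
  would otherwise be a finite sum lying outside \<open>\<nat>\<^sup>k\<close>.\<close>

definition simplex_points :: "('k::finite \<Rightarrow> real ^ 'k) \<Rightarrow> (real ^ 'k) set" where
  "simplex_points v = gen_simplex v \<inter> pos_points"

definition doublings :: "real ^ 'k \<Rightarrow> (real ^ 'k) set" where
  "doublings w = {2 ^ j *\<^sub>R w | j :: nat. True}"

definition summand_set :: "('k::finite \<Rightarrow> real ^ 'k) \<Rightarrow> (real ^ 'k) set" where
  "summand_set v = simplex_points v \<union> (\<Union>i. doublings (v i))"

end

theory Submission
  imports Defs "HOL-Library.Nat_Bijection"
begin

text \<open>Write a point of the cone as \<open>\<Sum>i. a i *\<^sub>R v i\<close> and split each \<open>a i\<close> into its integer and
  fractional part. The fractional parts give an integer point of the simplex, and the integer parts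
  are expanded in binary. Since the coefficients of the fractional point are below 1, it is not one of
  the vectors \<open>2 ^ j *\<^sub>R v i\<close>, so the summands are distinct. For thinness, the simplex has finitely
  many integer points and each of the \<open>k\<close> sequences has at most \<open>log 2 N + 1\<close> terms in the box, while
  the integer combinations of the \<open>v i\<close> with coefficients up to \<open>N / (k M)\<close>, with \<open>M\<close> a bound
  for the entries, already give at least a constant times \<open>N ^ k\<close> points of the cone.\<close>

section \<open>Coordinates with respect to the generators, and positive integer points\<close>

lemma coefficients_unique:
  fixes v :: "'k::finite \<Rightarrow> 'a::real_vector"
  assumes "inj v" "independent (range v)"
    and eq: "(\<Sum>i\<in>UNIV. a i *\<^sub>R v i) = (\<Sum>i\<in>UNIV. b i *\<^sub>R v i)"
  shows "a = b"
proof
  fix i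
  \<comment> \<open>Independence concerns the set \<open>range v\<close>, so coefficients indexed by
    \<open>i\<close> are carried over to vectors along \<open>inv v\<close>; injectivity of
    \<open>v\<close> makes this faithful.\<close>
  let ?u = "\<lambda>x. a (inv v x) - b (inv v x)"
  have "(\<Sum>x\<in>range v. ?u x *\<^sub>R x) = (\<Sum>i\<in>UNIV. (a i - b i) *\<^sub>R v i)"
    by (simp add: sum.reindex[OF assms(1)] inv_f_f[OF assms(1)])
  also have "\<dots> = 0"
    using eq by (simp add: scaleR_diff_left sum_subtractf)
  finally have "?u (v i) = 0"
    by (intro independentD[OF assms(2), of "range v" ?u "v i"]) auto
  then show "a i = b i"
    by (simp add: inv_f_f[OF assms(1)])
qed

lemma finite_vec_components_in:
  assumes "finite T"
  shows "finite {x :: 'a ^ 'n. \<forall>i. x $ i \<in> T}"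
proof (rule inj_on_finite[of vec_nth])
  show "finite (PiE UNIV (\<lambda>_ :: 'n. T))"
    using assms by (intro finite_PiE) auto
qed (auto simp: inj_on_def vec_eq_iff)

text \<open>Brings a multiple of a single generator into the form to which
  \<open>coefficients_unique\<close> and the definition of \<open>gen_cone\<close> apply.\<close>

lemma scaleR_eq_sum_delta:
  fixes v :: "'k::finite \<Rightarrow> 'a::real_vector"
  shows "c *\<^sub>R v i = (\<Sum>l\<in>UNIV. (if l = i then c else 0) *\<^sub>R v l)"
  by (simp add: if_distrib[where f = "\<lambda>c. c *\<^sub>R _"] cong: if_cong)

lemma pos_points_component_ge_1:
  assumes "x \<in> pos_points"
  shows "1 \<le> x $ j"
proof -
  have "x $ j \<in> \<nat>" and "x $ j \<noteq> 0"
    using assms by (auto simp: pos_points_def)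
  then obtain n where "x $ j = real n" "n \<noteq> 0"
    by (auto elim!: Nats_cases)
  then show ?thesis by (cases n) auto
qed

lemma pos_points_component_bounded:
  assumes "x \<in> pos_points" "x $ j \<le> real n"
  shows "x $ j \<in> real ` {..n}"
proof -
  have "x $ j \<in> \<nat>"
    using assms(1) by (simp add: pos_points_def)
  then show ?thesis
    using assms(2) by (auto elim!: Nats_cases)
qed

lemma pos_points_nat_scale:
  assumes "x \<in> pos_points" "m > 0"
  shows "real m *\<^sub>R x \<in> pos_points"
  using assms by (auto simp: pos_points_def)

lemma sum_pos_points:
  assumes "finite F" "F \<noteq> {}" "\<And>x. x \<in> F \<Longrightarrow> f x \<in> pos_points"
  shows "sum f F \<in> pos_points"
proof -
  have "(\<Sum>x\<in>F. f x $ j) \<in> \<nat>" for j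
    using assms(1,3) by (induction F) (auto simp: pos_points_def)
  \<comment> \<open>Nonemptiness of \<open>F\<close> enters here: an empty sum is 0, which
    \<open>pos_points\<close> excludes.\<close>
  moreover have "0 < (\<Sum>x\<in>F. f x $ j)" for j
    using assms pos_points_component_ge_1[of _ j]
    by (intro sum_pos) (auto intro: less_le_trans[OF zero_less_one])
  ultimately show ?thesis
    unfolding pos_points_def by (auto simp: less_imp_neq[symmetric])
qed

section \<open>The cone and its closure under sums\<close>

lemma gen_cone_zero: "0 \<in> gen_cone v"
  by (auto simp: gen_cone_def intro!: exI[of _ "\<lambda>_. 0"])

lemma gen_cone_add:
  assumes "x \<in> gen_cone v" "y \<in> gen_cone v"
  shows "x + y \<in> gen_cone v"
proof -
  obtain a b where "x = (\<Sum>i\<in>UNIV. a i *\<^sub>R v i)" "y = (\<Sum>i\<in>UNIV. b i *\<^sub>R v i)"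
    and nn: "\<forall>i. a i \<ge> 0" "\<forall>i. b i \<ge> 0"
    using assms unfolding gen_cone_def by blast
  then have "x + y = (\<Sum>i\<in>UNIV. (a i + b i) *\<^sub>R v i)"
    by (simp add: scaleR_add_left sum.distrib)
  with nn show ?thesis
    unfolding gen_cone_def by (auto intro!: exI[of _ "\<lambda>i. a i + b i"])
qed

lemma gen_cone_sum:
  assumes "\<And>x. x \<in> F \<Longrightarrow> f x \<in> gen_cone v"
  shows "sum f F \<in> gen_cone v"
  using assms
  by (induction F rule: infinite_finite_induct) (auto intro: gen_cone_add gen_cone_zero)

lemma scaleR_generator_in_gen_cone:
  assumes "c \<ge> 0"
  shows "c *\<^sub>R v i \<in> gen_cone v"
  unfolding gen_cone_def mem_Collect_eq
  using assms scaleR_eq_sum_delta[of c v i]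
  by (intro exI[of _ "\<lambda>l. if l = i then c else 0"]) auto

lemma gen_simplex_subset_gen_cone:
  fixes v :: "'k::finite \<Rightarrow> real ^ 'k"
  shows "gen_simplex v \<subseteq> gen_cone v"
proof
  fix x assume "x \<in> gen_simplex v"
  then obtain a where x: "x = (\<Sum>i\<in>UNIV. a i *\<^sub>R (real CARD('k) *\<^sub>R v i))" and "\<forall>i. a i \<ge> 0"
    unfolding gen_simplex_def by blast
  then show "x \<in> gen_cone v"
    by (auto intro!: gen_cone_sum scaleR_generator_in_gen_cone)
qed

lemma summand_set_subset_cone_points:
  assumes "\<And>i. v i \<in> pos_points"
  shows "summand_set v \<subseteq> cone_points v"
proof -
  have "2 ^ j *\<^sub>R v i \<in> cone_points v" for i and j :: nat
    using pos_points_nat_scale[OF assms, of "2 ^ j" i] scaleR_generator_in_gen_cone[of "2 ^ j" v i]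
    by (simp add: cone_points_def)
  then show ?thesis
    using gen_simplex_subset_gen_cone[of v]
    by (auto simp: summand_set_def simplex_points_def cone_points_def doublings_def)
qed

text \<open>The cone is closed under all finite sums and \<open>pos_points\<close> under nonempty
  ones, which are the only sums that \<open>FS\<close> admits.\<close>

lemma FS_subset_cone_points:
  assumes "X \<subseteq> cone_points v"
  shows "FS X \<subseteq> cone_points v"
  using assms
  by (auto simp: FS_def cone_points_def subset_iff intro!: gen_cone_sum sum_pos_points)

section \<open>Decomposition of cone points into distinct summands\<close>

lemma cone_points_subset_FS:
  fixes v :: "'k::finite \<Rightarrow> real ^ 'k"
  assumes pos: "\<And>i. v i \<in> pos_points"
    and inj: "inj v" and ind: "independent (range v)"
  shows "cone_points v \<subseteq> FS (summand_set v)"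
proof
  fix x assume x: "x \<in> cone_points v"
  then obtain a where xa: "x = (\<Sum>i\<in>UNIV. a i *\<^sub>R v i)" and a: "\<And>i. a i \<ge> 0"
    unfolding cone_points_def gen_cone_def by blast
  define s where "s = (\<Sum>i\<in>UNIV. frac (a i) *\<^sub>R v i)"
  \<comment> \<open>\<open>B i\<close> holds the positions of the binary digits 1 in the integer
    part of \<open>a i\<close>; \<open>G\<close> below collects the corresponding vectors.\<close>
  define B where "B i = set_decode (nat \<lfloor>a i\<rfloor>)" for i
  define g where "g = (\<lambda>(i, j). (2::real) ^ j *\<^sub>R v i)"
  define G where "G = g ` (SIGMA i:UNIV. B i)"
  have fin: "finite (SIGMA i:UNIV. B i)"
    by (auto simp: B_def)
  have inj_g: "inj g"
  proof (rule injI, clarify)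
    fix i j i' j' assume "g (i, j) = g (i', j')"
    then have "(\<Sum>l\<in>UNIV. (if l = i then 2 ^ j else 0) *\<^sub>R v l)
        = (\<Sum>l\<in>UNIV. (if l = i' then 2 ^ j' else 0) *\<^sub>R v l)"
      unfolding g_def prod.case scaleR_eq_sum_delta[of "2 ^ j" v i]
        scaleR_eq_sum_delta[of "2 ^ j'" v i'] .
    \<comment> \<open>The coefficient at \<open>i\<close> is the nonzero number \<open>2 ^ j\<close>
      on the left, which forces \<open>i = i'\<close>; then the two powers of 2 agree.\<close>
    from fun_cong[OF coefficients_unique[OF inj ind this], of i]
    show "i = i' \<and> j = j'"
      by (auto split: if_splits)
  qed
  have floor_sum: "(\<Sum>j\<in>B i. (2::real) ^ j) = of_int \<lfloor>a i\<rfloor>" for i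
  proof -
    \<comment> \<open>The digit expansion is an identity of natural numbers; it passes to the reals
      without loss since \<open>a i\<close> is nonnegative.\<close>
    have "(\<Sum>j\<in>B i. (2::nat) ^ j) = nat \<lfloor>a i\<rfloor>"
      using set_decode_inverse[of "nat \<lfloor>a i\<rfloor>"] by (simp add: B_def set_encode_def)
    then have "(\<Sum>j\<in>B i. (2::real) ^ j) = real (nat \<lfloor>a i\<rfloor>)"
      by (metis (mono_tags, lifting) of_nat_numeral of_nat_power of_nat_sum sum.cong)
    then show ?thesis
      using a[of i] by simp
  qed
  have "\<Sum>G = (\<Sum>(i, j)\<in>(SIGMA i:UNIV. B i). 2 ^ j *\<^sub>R v i)"
    unfolding G_def by (subst sum.reindex[OF inj_on_subset[OF inj_g]]) (auto simp: g_def)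
  also have "\<dots> = (\<Sum>i\<in>UNIV. \<Sum>j\<in>B i. 2 ^ j *\<^sub>R v i)"
    by (subst sum.Sigma) (auto simp: B_def)
  also have "\<dots> = (\<Sum>i\<in>UNIV. of_int \<lfloor>a i\<rfloor> *\<^sub>R v i)"
    by (simp add: floor_sum flip: scaleR_sum_left)
  finally have G_sum: "\<Sum>G = (\<Sum>i\<in>UNIV. of_int \<lfloor>a i\<rfloor> *\<^sub>R v i)" .
  then have x_split: "x = s + \<Sum>G"
    unfolding xa s_def by (simp add: frac_def flip: sum.distrib scaleR_add_left)
  have finG: "finite G"
    using fin by (simp add: G_def)
  have GX: "G \<subseteq> summand_set v"
    by (auto simp: G_def g_def summand_set_def doublings_def)
  show "x \<in> FS (summand_set v)"
  \<comment> \<open>If all fractional parts vanish, \<open>s\<close> is the origin and cannot serve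
    as a summand; \<open>G\<close> alone then suffices, and is nonempty because \<open>x\<close> is
    not 0.\<close>
  proof (cases "\<forall>i. frac (a i) = 0")
    case True
    then have "s = 0"
      unfolding s_def by (intro sum.neutral) (simp del: frac_eq_0_iff)
    then have "x = \<Sum>G"
      using x_split by simp
    moreover have "x \<noteq> 0"
      using x by (auto simp: cone_points_def pos_points_def)
    ultimately show ?thesis
      using finG GX unfolding FS_def by auto
  next
    case False
    then obtain i0 where i0: "frac (a i0) > 0"
      using frac_ge_0 by (metis order_le_less)
    \<comment> \<open>Every generator has only positive entries, so one positive fractional part
      makes all coordinates of \<open>s\<close> positive.\<close>
    have s_pos: "s $ j > 0" for j
    proof -
      have vj: "v i $ j > 0" for i
        using pos_points_component_ge_1[OF pos, of i j] by linarith
      have "0 < (\<Sum>i\<in>UNIV. frac (a i) * v i $ j)"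
        using vj i0 by (intro sum_pos2[of _ i0]) (auto simp: less_imp_le)
      then show ?thesis by (simp add: s_def)
    qed
    \<comment> \<open>\<open>s\<close> differs from the integer point \<open>x\<close> by an integer
      combination of the generators.\<close>
    have "s $ j \<in> \<nat>" for j
    proof -
      have "x $ j \<in> \<int>" "\<And>i. v i $ j \<in> \<int>"
        using x pos Nats_subset_Ints by (auto simp: cone_points_def pos_points_def)
      moreover have "s $ j = x $ j - (\<Sum>i\<in>UNIV. of_int \<lfloor>a i\<rfloor> * v i $ j)"
        using x_split G_sum by (simp add: algebra_simps)
      ultimately have "s $ j \<in> \<int>"
        by (auto intro!: Ints_diff Ints_sum Ints_mult)
      then show ?thesis
        using s_pos[of j] by (simp add: Nats_altdef2)
    qed
    then have "s \<in> pos_points"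
      using s_pos by (auto simp: pos_points_def less_imp_neq[symmetric])
    moreover have "s \<in> gen_simplex v"
    proof -
      \<comment> \<open>The \<open>k\<close> fractional parts sum to at most \<open>k\<close>; this
        explains the factor \<open>k\<close> in the simplex, whose coefficients are these parts
        divided by \<open>k\<close>.\<close>
      have "(\<Sum>i\<in>UNIV. frac (a i)) \<le> (\<Sum>i\<in>(UNIV::'k set). 1)"
        by (intro sum_mono) (simp add: frac_lt_1 less_imp_le)
      then have "(\<Sum>i\<in>UNIV. frac (a i) / real CARD('k)) \<le> 1"
        by (simp flip: sum_divide_distrib)
      then show ?thesis
        unfolding gen_simplex_def s_def
        by (auto intro!: exI[of _ "\<lambda>i. frac (a i) / real CARD('k)"])
    qed
    moreover have "s \<notin> G"
    proof
      assume "s \<in> G"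
      then obtain i j where "s = 2 ^ j *\<^sub>R v i"
        by (auto simp: G_def g_def)
      then have "(\<Sum>l\<in>UNIV. frac (a l) *\<^sub>R v l) = (\<Sum>l\<in>UNIV. (if l = i then 2 ^ j else 0) *\<^sub>R v l)"
        unfolding s_def scaleR_eq_sum_delta[of "2 ^ j" v i] .
      from fun_cong[OF coefficients_unique[OF inj ind this], of i]
      have "frac (a i) = 2 ^ j" by simp
      moreover have "(1::real) \<le> 2 ^ j" by simp
      ultimately show False
        using frac_lt_1[of "a i"] by linarith
    qed
    ultimately have "insert s G \<subseteq> summand_set v" "x = \<Sum>(insert s G)"
      using GX finG x_split by (auto simp: summand_set_def simplex_points_def)
    then show ?thesis
      using finG unfolding FS_def by blast
  qed
qed

section \<open>Counting points in the box\<close>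

lemma finite_simplex_points:
  fixes v :: "'k::finite \<Rightarrow> real ^ 'k"
  assumes M: "\<And>i j. v i $ j \<le> real M"
  shows "finite (simplex_points v)"
proof (rule finite_subset)
  show "finite {x :: real ^ 'k. \<forall>j. x $ j \<in> real ` {..CARD('k) * M}}"
    by (intro finite_vec_components_in) auto
  show "simplex_points v \<subseteq> {x. \<forall>j. x $ j \<in> real ` {..CARD('k) * M}}"
  proof (clarify)
    fix x j assume "x \<in> simplex_points v"
    then obtain a where x: "x = (\<Sum>i\<in>UNIV. a i *\<^sub>R (real CARD('k) *\<^sub>R v i))"
      and a: "\<forall>i. a i \<ge> 0" "(\<Sum>i\<in>UNIV. a i) \<le> 1" and xp: "x \<in> pos_points"
      unfolding simplex_points_def gen_simplex_def by blast
    \<comment> \<open>The vertices \<open>k v i\<close> have entries at most \<open>k M\<close>, and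
      the coefficients sum to at most 1.\<close>
    have "x $ j = (\<Sum>i\<in>UNIV. a i * (real CARD('k) * v i $ j))"
      by (simp add: x mult.assoc)
    also have "\<dots> \<le> (\<Sum>i\<in>UNIV. a i * (real CARD('k) * real M))"
      using a M by (intro sum_mono mult_left_mono) auto
    also have "\<dots> = (\<Sum>i\<in>UNIV. a i) * (real CARD('k) * real M)"
      by (simp add: sum_distrib_right)
    also have "\<dots> \<le> real (CARD('k) * M)"
      using mult_right_mono[OF a(2), of "real CARD('k) * real M"] by simp
    finally have "x $ j \<le> real (CARD('k) * M)" .
    with xp show "x $ j \<in> real ` {..CARD('k) * M}"
      by (rule pos_points_component_bounded)
  qed
qed

text \<open>As the entries of \<open>w\<close> are at least 1, a term
  \<open>2 ^ j *\<^sub>R w\<close> in the box has \<open>2 ^ j \<le> N\<close>; the summand 1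
  accounts for \<open>j = 0\<close>.\<close>

lemma count_upto_doublings_le:
  assumes "w \<in> pos_points" "N > 0"
  shows "finite (doublings w \<inter> {x. \<forall>i. 1 \<le> x $ i \<and> x $ i \<le> real N})"
    and "real (count_upto (doublings w) N) \<le> log 2 (real N) + 1"
proof -
  let ?D = "doublings w \<inter> {x. \<forall>i. 1 \<le> x $ i \<and> x $ i \<le> real N}"
  let ?L = "nat \<lfloor>log 2 (real N)\<rfloor>"
  have sub: "?D \<subseteq> (\<lambda>j. 2 ^ j *\<^sub>R w) ` {..?L}"
  proof
    fix x assume "x \<in> ?D"
    then obtain j :: nat where j: "x = 2 ^ j *\<^sub>R w" and le: "\<And>i. x $ i \<le> real N"
      unfolding doublings_def by blast
    \<comment> \<open>Any one coordinate will do; \<open>undefined\<close> names one.\<close>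
    have "2 ^ j * 1 \<le> 2 ^ j * w $ undefined"
      using pos_points_component_ge_1[OF assms(1)] by (intro mult_left_mono) auto
    also have "\<dots> \<le> real N"
      using le[of undefined] by (simp add: j)
    finally have "real j \<le> log 2 (real N)"
      using assms(2) by (intro le_log_of_power) auto
    then show "x \<in> (\<lambda>j. 2 ^ j *\<^sub>R w) ` {..?L}"
      by (auto simp: j le_nat_floor)
  qed
  then show "finite ?D"
    by (rule finite_subset) simp
  have "card ?D \<le> card {..?L}"
    by (rule surj_card_le[OF _ sub]) simp
  also have "\<dots> = ?L + 1"
    by simp
  finally have "real (card ?D) \<le> real ?L + 1"
    by linarith
  also have "\<dots> \<le> log 2 (real N) + 1"
    using assms(2) by (simp add: of_nat_floor)
  finally show "real (count_upto (doublings w) N) \<le> log 2 (real N) + 1"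
    by (simp add: count_upto_def)
qed

lemma count_upto_summand_set_le:
  fixes v :: "'k::finite \<Rightarrow> real ^ 'k"
  assumes "\<And>i. v i \<in> pos_points" "finite (simplex_points v)" "N > 0"
  shows "real (count_upto (summand_set v) N)
    \<le> real (card (simplex_points v)) + real CARD('k) * (log 2 (real N) + 1)"
proof -
  define Q where "Q = {x :: real ^ 'k. \<forall>i. 1 \<le> x $ i \<and> x $ i \<le> real N}"
  have fin: "finite (doublings (v i) \<inter> Q)" for i
    unfolding Q_def by (rule count_upto_doublings_le(1)[OF assms(1,3)])
  have "card (summand_set v \<inter> Q) \<le> card (simplex_points v \<union> (\<Union>i. doublings (v i) \<inter> Q))"
  proof (rule card_mono)
    show "finite (simplex_points v \<union> (\<Union>i. doublings (v i) \<inter> Q))"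
      using fin assms(2) by (intro finite_UnI finite_UN_I) auto
  qed (auto simp: summand_set_def)
  also have "\<dots> \<le> card (simplex_points v) + (\<Sum>i\<in>UNIV. card (doublings (v i) \<inter> Q))"
    by (intro order_trans[OF card_Un_le] add_left_mono card_UN_le) simp
  finally have "real (count_upto (summand_set v) N)
      \<le> real (card (simplex_points v)) + (\<Sum>i\<in>UNIV. real (count_upto (doublings (v i)) N))"
    unfolding count_upto_def Q_def[symmetric] by (simp flip: of_nat_sum of_nat_add)
  also have "(\<Sum>i\<in>UNIV. real (count_upto (doublings (v i)) N))
      \<le> (\<Sum>i\<in>(UNIV::'k set). log 2 (real N) + 1)"
    by (intro sum_mono count_upto_doublings_le(2) assms)
  finally show ?thesis
    by simp
qed

lemma count_upto_cone_points_ge: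
  fixes v :: "'k::finite \<Rightarrow> real ^ 'k"
  assumes pos: "\<And>i. v i \<in> pos_points" and inj: "inj v" and ind: "independent (range v)"
    and M: "\<And>i j. v i $ j \<le> real M" and n: "CARD('k) * M * n \<le> N"
  shows "n ^ CARD('k) \<le> count_upto (cone_points v) N"
proof -
  define Q where "Q = {x :: real ^ 'k. \<forall>i. 1 \<le> x $ i \<and> x $ i \<le> real N}"
  \<comment> \<open>Coefficients start at 1, so that every scaled generator lies in
    \<open>pos_points\<close>. Independence makes the \<open>n ^ k\<close> combinations
    distinct.\<close>
  define P where "P = PiE (UNIV::'k set) (\<lambda>_. {1..n})"
  define h where "h m = (\<Sum>i\<in>UNIV. real (m i) *\<^sub>R v i)" for m
  have finP: "finite P"
    by (auto simp: P_def intro: finite_PiE)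
  have "inj_on h P"
  proof (rule inj_onI)
    fix m m' assume "h m = h m'"
    then have "(\<lambda>i. real (m i)) = (\<lambda>i. real (m' i))"
      unfolding h_def by (rule coefficients_unique[OF inj ind])
    then show "m = m'"
      by (auto simp: fun_eq_iff)
  qed
  moreover have "h ` P \<subseteq> cone_points v \<inter> Q"
  proof (clarify)
    fix m assume "m \<in> P"
    then have m: "1 \<le> m i" "m i \<le> n" for i
      by (auto simp: P_def PiE_def Pi_def)
    have hp: "h m \<in> pos_points"
      unfolding h_def using m pos
      by (intro sum_pos_points pos_points_nat_scale) (auto simp: Suc_le_eq)
    have hc: "h m \<in> gen_cone v"
      unfolding h_def by (intro gen_cone_sum scaleR_generator_in_gen_cone) auto
    have "h m $ j \<le> real N" for j
    proof -
      have vn: "0 \<le> v i $ j" for i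
        using pos_points_component_ge_1[OF pos, of i j] by linarith
      have "h m $ j = (\<Sum>i\<in>UNIV. real (m i) * v i $ j)"
        by (simp add: h_def)
      also have "\<dots> \<le> (\<Sum>i\<in>(UNIV::'k set). real n * real M)"
        using m M vn by (intro sum_mono mult_mono) auto
      also have "\<dots> = real (CARD('k) * M * n)"
        by (simp add: algebra_simps)
      also have "\<dots> \<le> real N"
        using n of_nat_le_iff by blast
      finally show ?thesis .
    qed
    then show "h m \<in> cone_points v \<inter> Q"
      using hp hc pos_points_component_ge_1[OF hp] by (auto simp: cone_points_def Q_def)
  qed
  \<comment> \<open>Needed for a lower bound on the count, since \<open>card\<close> of an infinite
    set is 0.\<close>
  moreover have "finite (cone_points v \<inter> Q)"
  proof (rule finite_subset)
    show "cone_points v \<inter> Q \<subseteq> {x. \<forall>i. x $ i \<in> real ` {..N}}"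
      by (auto simp: cone_points_def Q_def intro: pos_points_component_bounded)
  qed (intro finite_vec_components_in, simp)
  ultimately have "card P \<le> card (cone_points v \<inter> Q)"
    by (rule card_inj_on_le)
  then show ?thesis
    by (simp add: P_def card_PiE count_upto_def Q_def)
qed

theorem theorem1p2:
  fixes v :: "'k::finite \<Rightarrow> real ^ 'k"
  assumes "\<And>i. v i \<in> pos_points"
    and "inj v" and "independent (range v)"
    and "\<And>i. \<not> parallel_to_axis (v i)"
  shows "cone_points v = FS (summand_set v) \<and>
    (\<exists>t::real. \<forall>\<^sub>F N in sequentially.
       real (count_upto (summand_set v) N) \<le> log 2 (real (count_upto (cone_points v) N)) + t)"
proof
  show "cone_points v = FS (summand_set v)"
    using cone_points_subset_FS[OF assms(1-3)]
      FS_subset_cone_points[OF summand_set_subset_cone_points[OF assms(1)]]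
    by (rule equalityI)
next
  let ?k = "CARD('k)"
  define M where "M = nat \<lceil>Max (range (\<lambda>(i, j). v i $ j))\<rceil>"
  have M: "v i $ j \<le> real M" for i j
  proof -
    have "v i $ j \<le> Max (range (\<lambda>(i, j). v i $ j))"
      by (rule Max_ge) (auto intro!: image_eqI[of _ _ "(i, j)"])
    then show ?thesis
      unfolding M_def by (meson order_trans real_nat_ceiling_ge)
  qed
  have "1 \<le> real M"
    using pos_points_component_ge_1[OF assms(1)] M order_trans by blast
  then have M0: "M > 0"
    by simp
  define C where "C = ?k * M"
  have C0: "C > 0"
    using M0 by (simp add: C_def)
  have fin: "finite (simplex_points v)"
    by (rule finite_simplex_points[OF M])
  \<comment> \<open>Obtained by inserting \<open>log 2 N \<le> log 2 (2 * C) + log 2 n\<close> into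
    the upper bound for \<open>summand_set v\<close> and separating off
    \<open>k * log 2 n\<close>.\<close>
  let ?t = "real (card (simplex_points v)) + real ?k * (log 2 (2 * real C) + 1)"
  have "real (count_upto (summand_set v) N) \<le> log 2 (real (count_upto (cone_points v) N)) + ?t"
    if N: "N \<ge> C" for N
  proof -
    \<comment> \<open>The largest \<open>n\<close> for which the lower bound on the cone count
      applies. Since \<open>n\<close> is at least 1, \<open>C * n + C\<close> is at most
      \<open>2 * C * n\<close>, so \<open>N\<close> exceeds \<open>n\<close> by at most a constant
      factor.\<close>
    define n where "n = N div C"
    have n0: "n > 0"
      using N C0 by (simp add: n_def div_greater_zero_iff)
    have "N < C * n + C"
      using C0 unfolding n_def by (metis div_mult_mod_eq mod_less_divisor mult.commute
          nat_add_left_cancel_less)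
    also have "\<dots> \<le> 2 * C * n"
      using n0 by (cases n) auto
    finally have "real N \<le> 2 * real C * real n"
      by (metis less_imp_le of_nat_le_iff of_nat_mult of_nat_numeral)
    then have "log 2 (real N) \<le> log 2 (2 * real C * real n)"
      using N C0 n0 by (subst log_le_cancel_iff) auto
    also have "\<dots> = log 2 (2 * real C) + log 2 (real n)"
      using C0 n0 by (subst log_mult) auto
    finally have logN: "log 2 (real N) \<le> log 2 (2 * real C) + log 2 (real n)" .
    have cnt: "n ^ ?k \<le> count_upto (cone_points v) N"
      by (rule count_upto_cone_points_ge[OF assms(1-3) M]) (simp add: n_def flip: C_def)
    have "real ?k * log 2 (real n) = log 2 (real (n ^ ?k))"
      using n0 by (simp add: log_nat_power)
    also have "\<dots> \<le> log 2 (real (count_upto (cone_points v) N))"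
    proof -
      have "0 < n ^ ?k" using n0 by simp
      moreover from this cnt have "0 < count_upto (cone_points v) N"
        by (rule less_le_trans)
      ultimately show ?thesis
        using cnt by (subst log_le_cancel_iff) (simp_all del: of_nat_power)
    qed
    finally have cone: "real ?k * log 2 (real n) \<le> log 2 (real (count_upto (cone_points v) N))" .
    have "real (count_upto (summand_set v) N)
        \<le> real (card (simplex_points v)) + real ?k * (log 2 (real N) + 1)"
      using N C0 by (intro count_upto_summand_set_le assms(1) fin) auto
    also have "\<dots> \<le> real (card (simplex_points v))
        + real ?k * (log 2 (2 * real C) + log 2 (real n) + 1)"
      using logN by (intro add_left_mono mult_left_mono) auto
    also have "\<dots> = real ?k * log 2 (real n) + ?t"
      by (simp add: algebra_simps)
    also have "\<dots> \<le> log 2 (real (count_upto (cone_points v) N)) + ?t"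
      using cone by simp
    finally show ?thesis .
  qed
  then show "\<exists>t::real. \<forall>\<^sub>F N in sequentially.
       real (count_upto (summand_set v) N) \<le> log 2 (real (count_upto (cone_points v) N)) + t"
    unfolding eventually_sequentially by blast
qed

end
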